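(* Let $f(x_1,x_2,x_3)$ be a non-degenerate ternary cubic form with real coefficients, let $H$ be its Hessian determinant, and let $U\subset\mathbb{R}^3$ be the open subset given by $H\neq 0$. Equip $U$ with the Hessian metric $g_{ij}=-\frac{1}{6}f_{ij}$, put $h=\det(g_{ij})=-H/6^3$, let $R_{ijkl}$ be the components of its curvature tensor, and let $S$ be the $S$-invariant of $f$. Then: (1) For all $i,j,k,l\in\{1,2,3\}$ with $i\neq j$ and $k\neq l$, there are indices $a,b\in\{1,2,3\}$ and a sign, depending only on $(i,j,k,l)$, such that on $U$ $$R_{ijkl}=\pm\frac{1}{4}\,\frac{S\,x_a x_b}{h}.$$ (2) For all tangent vectors $\xi=\sum_i\lambda_i\,\partial/\partial x_i$ and $\eta=\sum_j\mu_j\,\partial/\partial x_j$ at a point $(x_1,x_2,x_3)\in U$, $$-4h\,R(\xi,\eta,\xi,\eta)=S\,(\lambda_1\mu_2x_3+\lambda_2\mu_3x_1+\lambda_3\mu_1x_2-\lambda_2\mu_1x_3-\lambda_3\mu_2x_1-\lambda_1\mu_3x_2)^2 .$$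
   Context: Write the ternary cubic as $$f=a_{300}x_1^3+a_{030}x_2^3+a_{003}x_3^3+3a_{210}x_1^2x_2+3a_{201}x_1^2x_3+3a_{120}x_1x_2^2+3a_{021}x_2^2x_3+3a_{102}x_1x_3^2+3a_{012}x_2x_3^2+6a_{111}x_1x_2x_3 .$$ Non-degenerate means that the Hessian determinant is not identically zero. Subscripts on $f$ denote partial derivatives: $f_{ij}=\partial^2f/\partial x_i\partial x_j$, $f_{ijk}=\partial^3f/\partial x_i\partial x_j\partial x_k$. The Hessian determinant is $H=\det(f_{ij})$. The Aronhold $S$-invariant of $f$ is the degree-4 $SL_3$-invariant (normalized so that $a_{111}^4$ has coefficient $1$) $$\begin{aligned}S=\;&a_{300}a_{120}a_{021}a_{003}-a_{300}a_{120}a_{012}^2-a_{300}a_{111}a_{030}a_{003}+a_{300}a_{111}a_{021}a_{012}+a_{300}a_{102}a_{030}a_{012}\\&-a_{300}a_{102}a_{021}^2-a_{210}^2a_{021}a_{003}+a_{210}^2a_{012}^2+a_{210}a_{201}a_{030}a_{003}-a_{210}a_{201}a_{021}a_{012}\\&+a_{210}a_{120}a_{111}a_{003}-a_{210}a_{120}a_{102}a_{012}-2a_{210}a_{111}^2a_{012}+3a_{210}a_{111}a_{102}a_{021}-a_{210}a_{102}^2a_{030}\\&-a_{201}^2a_{030}a_{012}+a_{201}^2a_{021}^2-a_{201}a_{120}^2a_{003}+3a_{201}a_{120}a_{111}a_{012}-a_{201}a_{120}a_{102}a_{021}\\&-2a_{201}a_{111}^2a_{021}+a_{201}a_{111}a_{102}a_{030}+a_{120}^2a_{102}^2-2a_{120}a_{111}^2a_{102}+a_{111}^4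 .\end{aligned}$$ The Hessian metric is the pseudo-Riemannian metric on $U$ with matrix $(g_{ij})=(-\frac16 f_{ij})$. With the sign convention used here, its curvature tensor has components $$R_{ijkl}=-\frac{1}{144}\sum_{p,q=1}^3 g^{pq}\,(f_{jlp}f_{ikq}-f_{ilp}f_{jkq}),$$ where $(g^{pq})$ is the inverse matrix of $(g_{ij})$, and $R(\xi,\eta,\xi,\eta)=\sum_{i,j,k,l}R_{ijkl}\lambda_i\mu_j\lambda_k\mu_l$. *)

theory Defs
  imports "HOL-Analysis.Analysis"
begin

section \<open>Partial derivatives and the Hessian\<close>

definition partial :: "'n::finite \<Rightarrow> (real^'n \<Rightarrow> real) \<Rightarrow> real^'n \<Rightarrow> real"
  where "partial i F x = deriv (\<lambda>t. F (x + t *\<^sub>R axis i 1)) 0"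

definition hessian_matrix :: "(real^'n::finite \<Rightarrow> real) \<Rightarrow> real^'n \<Rightarrow> real^'n^'n"
  where "hessian_matrix F x = (\<chi> i j. partial i (partial j F) x)"

definition hessian_det :: "(real^'n::finite \<Rightarrow> real) \<Rightarrow> real^'n \<Rightarrow> real"
  where "hessian_det F x = det (hessian_matrix F x)"

definition nondegenerate :: "(real^'n::finite \<Rightarrow> real) \<Rightarrow> bool"
  where "nondegenerate F \<longleftrightarrow> (\<exists>x. hessian_det F x \<noteq> 0)"


section \<open>Curvature of a pseudo-Riemannian metric in coordinates\<close>

text \<open>
  A metric is given by its matrix of components with respect to the coordinate
  vector fields.  The function \<open>christoffel g k i j\<close> is the coefficient
  $\Gamma^k_{ij}$ of the Levi-Civita connection, and \<open>riemann_op g m i j k\<close> is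
  the \<open>m\<close>-th component of
  $R(\partial_i,\partial_j)\partial_k = \nabla_i\nabla_j\partial_k - \nabla_j\nabla_i\partial_k$.
\<close>

definition christoffel ::
  "(real^'n::finite \<Rightarrow> real^'n^'n) \<Rightarrow> 'n \<Rightarrow> 'n \<Rightarrow> 'n \<Rightarrow> real^'n \<Rightarrow> real"
  where "christoffel g k i j x =
    (1/2) * (\<Sum>l\<in>UNIV. matrix_inv (g x) $ k $ l *
      (partial i (\<lambda>y. g y $ j $ l) x + partial j (\<lambda>y. g y $ i $ l) x - partial l (\<lambda>y. g y $ i $ j) x))"

definition riemann_op ::
  "(real^'n::finite \<Rightarrow> real^'n^'n) \<Rightarrow> 'n \<Rightarrow> 'n \<Rightarrow> 'n \<Rightarrow> 'n \<Rightarrow> real^'n \<Rightarrow> real"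
  where "riemann_op g m i j k x =
    partial i (christoffel g m j k) x - partial j (christoffel g m i k) x
    + (\<Sum>p\<in>UNIV. christoffel g m i p x * christoffel g p j k x
                - christoffel g m j p x * christoffel g p i k x)"

text \<open>
  Sign convention: $R_{ijkl} = g(R(\partial_i,\partial_j)\partial_l,\partial_k)$, so that
  $R(\xi,\eta,\xi,\eta)$ is the numerator of the sectional curvature.
\<close>

definition curvature ::
  "(real^'n::finite \<Rightarrow> real^'n^'n) \<Rightarrow> 'n \<Rightarrow> 'n \<Rightarrow> 'n \<Rightarrow> 'n \<Rightarrow> real^'n \<Rightarrow> real"
  where "curvature g i j k l x = (\<Sum>m\<in>UNIV. g x $ k $ m * riemann_op g m i j l x)"

definition curvature_form ::
  "(real^'n::finite \<Rightarrow> real^'n^'n) \<Rightarrow> real^'n \<Rightarrow> real^'n \<Rightarrow> real^'n \<Rightarrow> real^'n \<Rightarrow> real^'n \<Rightarrow> real"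
  where "curvature_form g x \<xi> \<eta> \<zeta> \<theta> =
    (\<Sum>i\<in>UNIV. \<Sum>j\<in>UNIV. \<Sum>k\<in>UNIV. \<Sum>l\<in>UNIV.
      curvature g i j k l x * \<xi> $ i * \<eta> $ j * \<zeta> $ k * \<theta> $ l)"


section \<open>Ternary cubics\<close>

text \<open>
  A ternary cubic form is given by its coefficients: \<open>a i j k\<close> with \<open>i + j + k = 3\<close>
  is the coefficient $a_{ijk}$, the exponents being the indices.  The values of \<open>a\<close>
  at other indices are never used.
\<close>

definition ternary_cubic :: "(nat \<Rightarrow> nat \<Rightarrow> nat \<Rightarrow> real) \<Rightarrow> real^3 \<Rightarrow> real"
  where "ternary_cubic a x =
    a 3 0 0 * (x$1)^3 + a 0 3 0 * (x$2)^3 + a 0 0 3 * (x$3)^3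
    + 3 * a 2 1 0 * (x$1)^2 * x$2 + 3 * a 2 0 1 * (x$1)^2 * x$3
    + 3 * a 1 2 0 * x$1 * (x$2)^2 + 3 * a 0 2 1 * (x$2)^2 * x$3
    + 3 * a 1 0 2 * x$1 * (x$3)^2 + 3 * a 0 1 2 * x$2 * (x$3)^2
    + 6 * a 1 1 1 * x$1 * x$2 * x$3"

definition S_invariant :: "(nat \<Rightarrow> nat \<Rightarrow> nat \<Rightarrow> real) \<Rightarrow> real"
  where "S_invariant a =
      a 3 0 0 * a 1 2 0 * a 0 2 1 * a 0 0 3 - a 3 0 0 * a 1 2 0 * (a 0 1 2)^2
    - a 3 0 0 * a 1 1 1 * a 0 3 0 * a 0 0 3 + a 3 0 0 * a 1 1 1 * a 0 2 1 * a 0 1 2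
    + a 3 0 0 * a 1 0 2 * a 0 3 0 * a 0 1 2 - a 3 0 0 * a 1 0 2 * (a 0 2 1)^2
    - (a 2 1 0)^2 * a 0 2 1 * a 0 0 3 + (a 2 1 0)^2 * (a 0 1 2)^2
    + a 2 1 0 * a 2 0 1 * a 0 3 0 * a 0 0 3 - a 2 1 0 * a 2 0 1 * a 0 2 1 * a 0 1 2
    + a 2 1 0 * a 1 2 0 * a 1 1 1 * a 0 0 3 - a 2 1 0 * a 1 2 0 * a 1 0 2 * a 0 1 2
    - 2 * a 2 1 0 * (a 1 1 1)^2 * a 0 1 2 + 3 * a 2 1 0 * a 1 1 1 * a 1 0 2 * a 0 2 1
    - a 2 1 0 * (a 1 0 2)^2 * a 0 3 0
    - (a 2 0 1)^2 * a 0 3 0 * a 0 1 2 + (a 2 0 1)^2 * (a 0 2 1)^2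
    - a 2 0 1 * (a 1 2 0)^2 * a 0 0 3 + 3 * a 2 0 1 * a 1 2 0 * a 1 1 1 * a 0 1 2
    - a 2 0 1 * a 1 2 0 * a 1 0 2 * a 0 2 1
    - 2 * a 2 0 1 * (a 1 1 1)^2 * a 0 2 1 + a 2 0 1 * a 1 1 1 * a 1 0 2 * a 0 3 0
    + (a 1 2 0)^2 * (a 1 0 2)^2 - 2 * a 1 2 0 * (a 1 1 1)^2 * a 1 0 2 + (a 1 1 1)^4"

definition hessian_metric :: "(real^3 \<Rightarrow> real) \<Rightarrow> real^3 \<Rightarrow> real^3^3"
  where "hessian_metric f x = (\<chi> i j. - (1/6) * partial i (partial j f) x)"

definition hessian_domain :: "(real^3 \<Rightarrow> real) \<Rightarrow> (real^3) set"
  where "hessian_domain f = {x. hessian_det f x \<noteq> 0}"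

lemma det_hessian_metric: "det (hessian_metric f x) = - hessian_det f x / 6^3"
  by (simp add: hessian_metric_def hessian_det_def hessian_matrix_def det_3)


section \<open>The curvature tensor of the Hessian metric of a ternary cubic\<close>

text \<open>
  \<open>cubic_coeff c\<close> is the symmetric coefficient tensor: the entry at \<open>i j k\<close> is the
  coefficient whose exponents count the occurrences of \<open>1\<close>, \<open>2\<close>, \<open>3\<close> among
  the indices.
\<close>

definition cubic_coeff :: "(nat \<Rightarrow> nat \<Rightarrow> nat \<Rightarrow> real) \<Rightarrow> 3 \<Rightarrow> 3 \<Rightarrow> 3 \<Rightarrow> real" where
 "cubic_coeff c i j k = (let n = (\<lambda>m::3. (if i=m then 1 else 0)+(if j=m then 1 else 0)+(if k=m then 1 else 0)::nat) in c (n 1) (n 2) (n 3))"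

lemma partialI: "((\<lambda>t. F (x + t *\<^sub>R axis i 1)) has_real_derivative D) (at 0) \<Longrightarrow> partial i F x = D"
  unfolding partial_def by (rule DERIV_imp_deriv)

lemma cubic_coeff_sym: "cubic_coeff c i j k = cubic_coeff c j i k" "cubic_coeff c i j k = cubic_coeff c i k j"
  by (simp_all add: cubic_coeff_def add_ac)

lemma partial1: "partial i (ternary_cubic c) = (\<lambda>x. 3 * (\<Sum>j\<in>UNIV. \<Sum>k\<in>UNIV. cubic_coeff c i j k * x$j * x$k))"
proof
  fix x
  consider "i=1"|"i=2"|"i=3" using exhaust_3 by blast
  then show "partial i (ternary_cubic c) x = 3 * (\<Sum>j\<in>UNIV. \<Sum>k\<in>UNIV. cubic_coeff c i j k * x$j * x$k)"
    by cases ((rule partialI, unfold ternary_cubic_def, (auto intro!: derivative_eq_intros simp: axis_def; simp add: sum_3 cubic_coeff_def Let_def numeral_eq_Suc power2_eq_square algebra_simps))[1])+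
qed

lemma partial2: "partial i (partial j (ternary_cubic c)) = (\<lambda>x. 6 * (\<Sum>k\<in>UNIV. cubic_coeff c i j k * x$k))"
proof
  fix x
  consider "i=1"|"i=2"|"i=3" using exhaust_3 by blast
  then show "partial i (partial j (ternary_cubic c)) x = 6 * (\<Sum>k\<in>UNIV. cubic_coeff c i j k * x$k)"
    unfolding partial1
    by cases ((rule partialI, unfold sum_3, (auto intro!: derivative_eq_intros simp: axis_def; simp add: cubic_coeff_def Let_def algebra_simps))[1])+
qed

lemma partial_lin: "partial i (\<lambda>x. r * (\<Sum>k\<in>UNIV. b k * x$k)) = (\<lambda>x::real^'n::finite. r * b i)"
proof
  fix x :: "real^'n"
  have "((\<lambda>t. r * (\<Sum>k\<in>UNIV. b k * (x + t *\<^sub>R axis i 1)$k)) has_real_derivative r * (\<Sum>k\<in>UNIV. b k * axis i 1 $ k)) (at 0)"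
    by (auto intro!: derivative_eq_intros sum.cong simp: axis_def)
  also have "(\<Sum>k\<in>UNIV. b k * axis i 1 $ k) = b i"
    by (simp add: axis_def if_distrib cong: if_cong)
  finally show "partial i (\<lambda>x. r * (\<Sum>k\<in>UNIV. b k * x$k)) x = r * b i"
    by (rule partialI)
qed

lemma partial3: "partial i (partial j (partial k (ternary_cubic c))) = (\<lambda>x. 6 * cubic_coeff c i j k)"
  unfolding partial2 partial_lin by (auto simp: fun_eq_iff cubic_coeff_sym)

lemma hm: "hessian_metric (ternary_cubic c) x $ i $ j = - (\<Sum>k\<in>UNIV. cubic_coeff c i j k * x$k)"
  by (simp add: hessian_metric_def partial2)

lemma partial_metric: "partial i (\<lambda>y. hessian_metric (ternary_cubic c) y $ j $ k) = (\<lambda>x. - cubic_coeff c i j k)"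
  using partial_lin[of i "-1" "cubic_coeff c j k"] cubic_coeff_sym[of c] by (simp add: hm fun_eq_iff sum_negf)

lemma christoffel_eq: "christoffel (hessian_metric (ternary_cubic c)) k i j x
   = - (1/2) * (\<Sum>l\<in>UNIV. matrix_inv (hessian_metric (ternary_cubic c) x) $ k $ l * cubic_coeff c i j l)"
proof -
  have e: "cubic_coeff c j i l = cubic_coeff c i j l" "cubic_coeff c l i j = cubic_coeff c i j l" for l by (metis cubic_coeff_sym)+
  show ?thesis by (simp add: christoffel_def partial_metric e sum_negf)
qed

lemma minv:
  fixes A :: "real^'n::finite^'n"
  assumes "det A \<noteq> 0"
  shows "A ** matrix_inv A = mat 1" "matrix_inv A ** A = mat 1"
proof -
  have "\<exists>A'. A ** A' = mat 1 \<and> A' ** A = mat 1"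
    using assms by (simp add: invertible_det_nz[symmetric] invertible_def)
  then have "A ** matrix_inv A = mat 1 \<and> matrix_inv A ** A = mat 1"
    unfolding matrix_inv_def by (rule someI_ex)
  then show "A ** matrix_inv A = mat 1" "matrix_inv A ** A = mat 1" by auto
qed

lemma det_diff:
  fixes G :: "real \<Rightarrow> real^'n::finite^'n"
  assumes "\<And>i j. (\<lambda>t. G t $ i $ j) differentiable (at 0)"
  shows "(\<lambda>t. det (G t)) differentiable (at 0)"
proof -
  obtain D where D: "\<And>i j. ((\<lambda>t. G t $ i $ j) has_real_derivative D i j) (at 0)"
    using assms unfolding real_differentiable_def by metis
  have "\<exists>D'. ((\<lambda>t. det (G t)) has_real_derivative D') (at 0)"
    unfolding det_def
    by (rule exI, rule DERIV_sum, rule DERIV_cmult, rule has_field_derivative_prod, rule D)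
  then show ?thesis by (simp add: real_differentiable_def)
qed

lemma matrix_inv_entry:
  fixes A :: "real^'n::finite^'n"
  assumes "det A \<noteq> 0"
  shows "matrix_inv A $ k $ l = det (\<chi> i j. if j = k then axis l 1 $ i else A$i$j) / det A"
proof -
  have "A ** matrix_inv A = mat 1"
    using assms by (rule minv)
  then have "A *v (matrix_inv A *v axis l 1) = axis l 1"
    by (simp add: matrix_vector_mul_assoc)
  then have "matrix_inv A *v axis l 1 = (\<chi> k. det(\<chi> i j. if j=k then axis l 1$i else A$i$j) / det A)"
    using cramer[OF assms] by blast
  moreover have "(matrix_inv A *v axis l 1) $ k = matrix_inv A $ k $ l"
    by (simp add: matrix_vector_mult_def axis_def if_distrib cong: if_cong)
  ultimately show ?thesis by simp
qed

lemma inv_derivative: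
  fixes G :: "real \<Rightarrow> real^'n::finite^'n"
  assumes G: "\<And>i j. ((\<lambda>t. G t $ i $ j) has_real_derivative G' $ i $ j) (at 0)" and d: "det (G 0) \<noteq> 0"
  shows "((\<lambda>t. matrix_inv (G t) $ k $ l) has_real_derivative
     - (matrix_inv (G 0) ** G' ** matrix_inv (G 0)) $ k $ l) (at 0)"
proof -
  have dd: "(\<lambda>t. det (G t)) differentiable (at 0)"
    using G by (intro det_diff) (auto simp: real_differentiable_def)
  have dd2: "(\<lambda>t. det (\<chi> i j. if j = k then axis l 1 $ i else G t$i$j)) differentiable (at 0)" for k l
    proof (rule det_diff)
    fix i j
    show "(\<lambda>t. (\<chi> i j. if j = k then axis l 1 $ i else G t$i$j) $ i $ j) differentiable (at 0)"
      using G[of i j] by (cases "j = k") (auto simp: real_differentiable_def)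
  qed
  have ev: "\<forall>\<^sub>F t in nhds 0. det (G t) \<noteq> 0"
  proof -
    have "isCont (\<lambda>t. det (G t)) 0" using dd by (simp add: differentiable_imp_continuous_within)
    then have "\<forall>\<^sub>F t in at 0. det (G t) \<noteq> 0" using d 
      by (metis isCont_def tendsto_imp_eventually_ne)
    then show ?thesis using d by (simp add: eventually_nhds_conv_at)
  qed
  have "\<exists>D. ((\<lambda>t. matrix_inv (G t) $ k $ l) has_real_derivative D) (at 0)" for k l
  proof -
    obtain D where "((\<lambda>t. det (\<chi> i j. if j = k then axis l 1 $ i else G t$i$j) / det (G t)) has_real_derivative D) (at 0)"
      using differentiable_divide[OF dd2 dd d] real_differentiable_def by blast
    note D = this
    have E: "\<forall>\<^sub>F t in nhds 0. matrix_inv (G t) $ k $ l = det (\<chi> i j. if j = k then axis l 1 $ i else G t$i$j) / det (G t)"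
      using ev by eventually_elim (rule matrix_inv_entry)
    show ?thesis by (rule exI, rule DERIV_cong_ev[THEN iffD2, OF refl E refl D])
  qed
  then obtain N where N: "\<And>k l. ((\<lambda>t. matrix_inv (G t) $ k $ l) has_real_derivative N k l) (at 0)" by metis
  define N' :: "real^'n^'n" where "N' = (\<chi> i j. N i j)"
  have "N' ** G 0 + matrix_inv (G 0) ** G' = 0"
  proof (simp add: vec_eq_iff, intro allI)
    fix i j
    have "((\<lambda>t. (matrix_inv (G t) ** G t) $ i $ j) has_real_derivative (\<Sum>k\<in>UNIV. N i k * G 0 $ k $ j + matrix_inv (G 0) $ i $ k * G' $ k $ j)) (at 0)"
      unfolding matrix_matrix_mult_def
      by (auto intro!: derivative_eq_intros N G sum.cong)
    moreover have "((\<lambda>t. (matrix_inv (G t) ** G t) $ i $ j) has_real_derivative 0) (at 0)"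
    proof -
      have E: "\<forall>\<^sub>F t in nhds 0. (matrix_inv (G t) ** G t) $ i $ j = mat 1 $ i $ j"
        using ev by eventually_elim (simp add: minv)
      show ?thesis by (rule DERIV_cong_ev[THEN iffD2, OF refl E refl DERIV_const])
    qed
    ultimately have "(\<Sum>k\<in>UNIV. N i k * G 0 $ k $ j + matrix_inv (G 0) $ i $ k * G' $ k $ j) = 0"
      by (rule DERIV_unique)
    then show "(N' ** G 0) $ i $ j + (matrix_inv (G 0) ** G') $ i $ j = 0"
      by (simp add: matrix_matrix_mult_def N'_def sum.distrib)
  qed
  then have "N' ** G 0 = - (matrix_inv (G 0) ** G')" by (simp add: eq_neg_iff_add_eq_0)
  then have "N' ** G 0 ** matrix_inv (G 0) = - (matrix_inv (G 0) ** G') ** matrix_inv (G 0)" by simp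
  moreover have "G 0 ** matrix_inv (G 0) = mat 1"
    using d by (rule minv)
  ultimately have "N' = - (matrix_inv (G 0) ** G') ** matrix_inv (G 0)"
    by (metis matrix_mul_assoc matrix_mul_rid)
  then have "N k l = - (matrix_inv (G 0) ** G' ** matrix_inv (G 0)) $ k $ l"
    by (simp add: N'_def vec_eq_iff matrix_matrix_mult_def sum_negf)
  then show ?thesis using N by metis
qed


lemma partial_inv_metric:
  assumes "x \<in> hessian_domain (ternary_cubic c)"
  shows "((\<lambda>t. matrix_inv (hessian_metric (ternary_cubic c) (x + t *\<^sub>R axis i 1)) $ k $ l) has_real_derivative
    (let N = matrix_inv (hessian_metric (ternary_cubic c) x) in \<Sum>p\<in>UNIV. \<Sum>q\<in>UNIV. N $ k $ p * cubic_coeff c i p q * N $ q $ l)) (at 0)"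
proof -
  let ?G = "\<lambda>t. hessian_metric (ternary_cubic c) (x + t *\<^sub>R axis i 1)"
  have "det (?G 0) \<noteq> 0" using assms by (simp add: hessian_domain_def det_hessian_metric)
  moreover have "((\<lambda>t. ?G t $ p $ q) has_real_derivative (\<chi> p q. - cubic_coeff c i p q) $ p $ q) (at 0)" for p q
  proof -
    have "((\<lambda>t. ?G t $ p $ q) has_real_derivative - (\<Sum>k\<in>UNIV. cubic_coeff c p q k * axis i 1 $ k)) (at 0)"
      unfolding hm by (auto intro!: derivative_eq_intros sum.cong simp: axis_def)
    also have "(\<Sum>k\<in>UNIV. cubic_coeff c p q k * axis i 1 $ k) = cubic_coeff c p q i"
      by (simp add: axis_def if_distrib cong: if_cong)
    also have "cubic_coeff c p q i = cubic_coeff c i p q" by (metis cubic_coeff_sym)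
    finally show ?thesis by simp
  qed
  ultimately have "((\<lambda>t. matrix_inv (?G t) $ k $ l) has_real_derivative
     - (matrix_inv (?G 0) ** (\<chi> p q. - cubic_coeff c i p q) ** matrix_inv (?G 0)) $ k $ l) (at 0)"
    by (intro inv_derivative)
  moreover have "- (matrix_inv (?G 0) ** (\<chi> p q. - cubic_coeff c i p q) ** matrix_inv (?G 0)) $ k $ l = 
    (let N = matrix_inv (hessian_metric (ternary_cubic c) x) in \<Sum>p\<in>UNIV. \<Sum>q\<in>UNIV. N $ k $ p * cubic_coeff c i p q * N $ q $ l)"
    by (simp add: matrix_matrix_mult_def Let_def sum_3 algebra_simps)
  ultimately show ?thesis by simp
qed

text \<open>
  For a cubic the third derivatives are constant, and the general curvature tensor of
  the Hessian metric reduces to the following expression; in particular this confirms the sign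
  convention.
\<close>

lemma curvature_hessian_metric:
  fixes c defines "f \<equiv> ternary_cubic c"
  assumes "x \<in> hessian_domain f"
  shows "curvature (hessian_metric f) i j k l x = - (1/144) *
    (\<Sum>p\<in>UNIV. \<Sum>q\<in>UNIV. matrix_inv (hessian_metric f x) $ p $ q *
      (partial j (partial l (partial p f)) x * partial i (partial k (partial q f)) x
     - partial i (partial l (partial p f)) x * partial j (partial k (partial q f)) x))"
proof -
  define g where "g = hessian_metric f x"
  define N where "N = matrix_inv g"
  have d: "det g \<noteq> 0" using assms by (simp add: g_def hessian_domain_def det_hessian_metric)
  have dch: "partial i (christoffel (hessian_metric f) m j k) x =
     - (1/2) * (\<Sum>r\<in>UNIV. (\<Sum>p\<in>UNIV. \<Sum>q\<in>UNIV. N $ m $ p * cubic_coeff c i p q * N $ q $ r) * cubic_coeff c j k r)" for i j k m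
    unfolding f_def christoffel_eq
    using partial_inv_metric[OF assms(2)[unfolded f_def], of i m]
    by (intro partialI DERIV_cmult DERIV_sum DERIV_cmult_right)
       (simp add: N_def g_def f_def Let_def)
  have ch: "christoffel (hessian_metric f) m i j x = - (1/2) * (\<Sum>r\<in>UNIV. N $ m $ r * cubic_coeff c i j r)" for i j m
    by (simp add: f_def christoffel_eq N_def g_def)
  define A where "A = (\<lambda>i p q. cubic_coeff c i p q)"
  have gN: "(\<Sum>m\<in>UNIV. g $ k $ m * (\<Sum>p\<in>UNIV. N $ m $ p * v p)) = v k" for k v
  proof -
    have "(\<Sum>m\<in>UNIV. g $ k $ m * N $ m $ p) = (if k = p then 1 else 0)" for p
      using minv(1)[OF d] by (simp add: N_def matrix_matrix_mult_def mat_def vec_eq_iff)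
    then have "(\<Sum>p\<in>UNIV. (\<Sum>m\<in>UNIV. g $ k $ m * N $ m $ p) * v p) = (\<Sum>p\<in>UNIV. (if k = p then 1 else 0) * v p)"
      by presburger
    also have "\<dots> = v k"
      by (simp add: if_distrib[of "\<lambda>u. u * _"] cong: if_cong)
    finally have "(\<Sum>p\<in>UNIV. (\<Sum>m\<in>UNIV. g $ k $ m * N $ m $ p) * v p) = v k" .
    moreover have "(\<Sum>m\<in>UNIV. g $ k $ m * (\<Sum>p\<in>UNIV. N $ m $ p * v p)) = (\<Sum>p\<in>UNIV. (\<Sum>m\<in>UNIV. g $ k $ m * N $ m $ p) * v p)"
      by (simp add: sum_3 algebra_simps)
    ultimately show ?thesis by simp
  qed
  define w where "w = (\<lambda>j l q. \<Sum>r\<in>UNIV. N $ q $ r * cubic_coeff c j l r)"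
  have op: "riemann_op (hessian_metric f) m i j l x = (\<Sum>p\<in>UNIV. N $ m $ p *
      ((\<Sum>q\<in>UNIV. - (1/4) * (cubic_coeff c i p q * w j l q - cubic_coeff c j p q * w i l q))))" for m
  proof -
    have s: "cubic_coeff c i q p = cubic_coeff c i p q" for i p q by (rule cubic_coeff_sym)
    have 1: "(\<Sum>r\<in>UNIV. (\<Sum>p\<in>UNIV. \<Sum>q\<in>UNIV. N $ m $ p * cubic_coeff c i p q * N $ q $ r) * cubic_coeff c j l r)
      = (\<Sum>p\<in>UNIV. N $ m $ p * (\<Sum>q\<in>UNIV. cubic_coeff c i p q * w j l q))" for i j
      unfolding w_def by (simp add: sum_3 algebra_simps)
    have 2: "(\<Sum>p\<in>UNIV. w i p m * w j l p) = (\<Sum>p\<in>UNIV. N $ m $ p * (\<Sum>q\<in>UNIV. cubic_coeff c i p q * w j l q))" for i j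
      by (subst w_def, simp add: sum_3 algebra_simps, simp add: s[of _ 2 1] s[of _ 3 1] s[of _ 3 2])
    have 3: "(\<Sum>p\<in>UNIV. christoffel (hessian_metric f) m i p x * christoffel (hessian_metric f) p j l x
       - christoffel (hessian_metric f) m j p x * christoffel (hessian_metric f) p i l x)
      = (1/4) * ((\<Sum>p\<in>UNIV. w i p m * w j l p) - (\<Sum>p\<in>UNIV. w j p m * w i l p))"
    proof -
      have c: "christoffel (hessian_metric f) m i j x = - (1/2) * w i j m" for i j m
        by (simp add: ch w_def)
      show ?thesis unfolding c by (simp add: sum_3 algebra_simps)
    qed
    have 4: "riemann_op (hessian_metric f) m i j l x = - (1/4) *
      ((\<Sum>p\<in>UNIV. N $ m $ p * (\<Sum>q\<in>UNIV. cubic_coeff c i p q * w j l q)) - (\<Sum>p\<in>UNIV. N $ m $ p * (\<Sum>q\<in>UNIV. cubic_coeff c j p q * w i l q)))"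
      unfolding riemann_op_def 3 dch[of i m j l] dch[of j m i l] 1 2[of i j] 2[of j i] by (simp add: field_simps)
    show ?thesis unfolding 4 by (simp add: sum_3 algebra_simps)
  qed
  have cu: "curvature (hessian_metric f) i j k l x = (\<Sum>q\<in>UNIV. - (1/4) * (cubic_coeff c i k q * w j l q - cubic_coeff c j k q * w i l q))"
    unfolding curvature_def op using gN by (simp add: g_def)
  have Nsym: "N $ p $ q = N $ q $ p" for p q
  proof -
    have tg: "transpose g = g"
      by (simp add: g_def f_def transpose_def vec_eq_iff hm cubic_coeff_sym(1)[of c])
    have "transpose N ** g = mat 1"
      using arg_cong[OF minv(1)[OF d], of transpose] by (simp add: matrix_transpose_mul tg N_def)
    then have "transpose N = N"
      using minv(1)[OF d] matrix_mul_assoc[of "transpose N" g N] by (simp add: N_def)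
    then have "transpose N $ p $ q = N $ p $ q" by simp
    then show ?thesis by (simp add: transpose_def)
  qed
  have sw: "(\<Sum>q\<in>UNIV. cubic_coeff c i k q * w j l q) = (\<Sum>p\<in>UNIV. \<Sum>q\<in>UNIV. N $ p $ q * (cubic_coeff c j l p * cubic_coeff c i k q))" for i j
    unfolding w_def sum_distrib_left
    by (subst sum.swap, rule sum.cong[OF refl], rule sum.cong[OF refl], subst Nsym) (simp add: ac_simps)
  have "curvature (hessian_metric f) i j k l x = - (1/4) * ((\<Sum>q\<in>UNIV. cubic_coeff c i k q * w j l q) - (\<Sum>q\<in>UNIV. cubic_coeff c j k q * w i l q))"
    unfolding cu sum_distrib_left[symmetric] sum_subtractf ..
  also have "\<dots> = - (1/4) * (\<Sum>p\<in>UNIV. \<Sum>q\<in>UNIV. N $ p $ q * (cubic_coeff c j l p * cubic_coeff c i k q - cubic_coeff c i l p * cubic_coeff c j k q))"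
    unfolding sw by (simp add: sum_subtractf right_diff_distrib)
  also have "\<dots> = - (1/144) * (\<Sum>p\<in>UNIV. \<Sum>q\<in>UNIV. N $ p $ q * (6 * cubic_coeff c j l p * (6 * cubic_coeff c i k q) - 6 * cubic_coeff c i l p * (6 * cubic_coeff c j k q)))"
  proof -
    have "N $ p $ q * (6 * cubic_coeff c j l p * (6 * cubic_coeff c i k q) - 6 * cubic_coeff c i l p * (6 * cubic_coeff c j k q))
      = 36 * (N $ p $ q * (cubic_coeff c j l p * cubic_coeff c i k q - cubic_coeff c i l p * cubic_coeff c j k q))" for p q
      by (simp add: algebra_simps)
    note e = this
    show ?thesis unfolding e sum_distrib_left[symmetric] by simp
  qed
  finally show ?thesis unfolding g_def[symmetric] N_def[symmetric] unfolding f_def partial3 .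
qed

end

theory Submission
  imports Defs
begin

text \<open>
  Write \<open>A\<^sub>p\<^sub>q\<close> for the cofactors of the metric matrix at \<open>x\<close>, so that the inverse metric is
  \<open>A\<^sub>p\<^sub>q / h\<close>, and \<open>c\<^sub>i\<^sub>j\<^sub>k\<close> for the symmetric tensor of coefficients of the cubic, so that
  \<open>f\<^sub>i\<^sub>j\<^sub>k = 6 c\<^sub>i\<^sub>j\<^sub>k\<close> and \<open>g\<^sub>i\<^sub>j = - \<Sum>\<^sub>k c\<^sub>i\<^sub>j\<^sub>k x\<^sub>k\<close>. Clearing the denominator in the curvature gives
  \<open>- 4 h R\<^sub>i\<^sub>j\<^sub>k\<^sub>l = \<Sum>\<^sub>p\<^sub>q A\<^sub>p\<^sub>q (c\<^sub>j\<^sub>l\<^sub>p c\<^sub>i\<^sub>k\<^sub>q - c\<^sub>i\<^sub>l\<^sub>p c\<^sub>j\<^sub>k\<^sub>q)\<close>, a quadratic polynomial in \<open>x\<close>, called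
  \<open>gauss_form\<close> below because it has the shape of the right-hand side of the Gauss equation.

  There is a structural reason why this polynomial is so simple. It is skew in \<open>i, j\<close>
  and in \<open>k, l\<close>, and in dimension three a skew form in two indices is a vector paired with the
  cross product of its arguments. By Euler's relation the radial vector \<open>x\<close> lies in the
  kernel of the form: contracting \<open>c\<^sub>i\<^sub>k\<^sub>q\<close> with \<open>x\<^sub>i\<close> gives \<open>- g\<^sub>k\<^sub>q\<close>, which cancels the inverse metric
  and leaves \<open>c\<^sub>j\<^sub>k\<^sub>l - c\<^sub>j\<^sub>k\<^sub>l = 0\<close> up to a factor. Hence the vector attached to each pair
  is a multiple of \<open>x\<close>, and
  \<open>- 4 h R\<^sub>i\<^sub>j\<^sub>k\<^sub>l = s ((e\<^sub>i \<times> e\<^sub>j) \<bullet> x) ((e\<^sub>k \<times> e\<^sub>l) \<bullet> x)\<close>. Both sides are polynomial and quadratic in \<open>x\<close>, so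
  \<open>s\<close> is a constant, a quartic in the coefficients. It is the invariant \<open>S\<close>.

  The proof establishes the six independent components by expanding both sides
  (\<open>gauss_form_components\<close>), which yields the proportionality and the value of the constant
  together. The symmetries of the form then spread them to all
  indices (\<open>gauss_form_eq\<close>). Since a cross product of two distinct basis vectors is plus or minus a basis
  vector, this is the first claim. Summing against the components of the tangent vectors
  turns basis cross products into \<open>(\<xi> \<times> \<eta>) \<bullet> x\<close>, and this is the second.
\<close>

unbundle cross3_syntax

text \<open>
  Adding to the index type \<open>3\<close> is cyclic. Reading the complementary rows and columns in cyclic order
  makes the \<open>2 \<times> 2\<close> minor already carry the sign \<open>(-1)\<^sup>p\<^sup>+\<^sup>q\<close>.
\<close>

definition cofactor :: "real^3^3 \<Rightarrow> 3 \<Rightarrow> 3 \<Rightarrow> real"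
  where "cofactor A p q = A $ (p+1) $ (q+1) * A $ (p+2) $ (q+2) - A $ (p+1) $ (q+2) * A $ (p+2) $ (q+1)"

lemma numerals_3_wrap: "(4::3) = 1" "(5::3) = 2"
  by simp_all

lemma det_mult_matrix_inv_3:
  fixes A :: "real^3^3"
  assumes "det A \<noteq> 0"
  shows "det A * matrix_inv A $ p $ q = cofactor A q p"
proof -
  have "det A * matrix_inv A $ p $ q = det (\<chi> i j. if j = p then axis q 1 $ i else A $ i $ j)"
    using assms by (simp add: matrix_inv_entry)
  also have "\<dots> = cofactor A q p"
    using exhaust_3[of p] exhaust_3[of q]
    by (elim disjE) (simp_all add: det_3 cofactor_def axis_def numerals_3_wrap algebra_simps)
  finally show ?thesis .
qed

text \<open>
  The curvature tensor multiplied by \<open>- 4 h\<close>. Using cofactors in place of the inverse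
  metric makes it a polynomial, defined also where the Hessian vanishes.
\<close>

definition gauss_form :: "(nat \<Rightarrow> nat \<Rightarrow> nat \<Rightarrow> real) \<Rightarrow> real^3 \<Rightarrow> 3 \<Rightarrow> 3 \<Rightarrow> 3 \<Rightarrow> 3 \<Rightarrow> real"
  where "gauss_form c x i j k l =
    (\<Sum>p\<in>UNIV. \<Sum>q\<in>UNIV. cofactor (hessian_metric (ternary_cubic c) x) p q *
      (cubic_coeff c j l p * cubic_coeff c i k q - cubic_coeff c i l p * cubic_coeff c j k q))"

lemma cofactor_hessian_metric_sym:
  "cofactor (hessian_metric (ternary_cubic c) x) p q = cofactor (hessian_metric (ternary_cubic c) x) q p"
  by (simp add: cofactor_def hm cubic_coeff_sym(1)[of c "p+1"] cubic_coeff_sym(1)[of c "p+2"])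

lemma curvature_eq_gauss_form:
  assumes "x \<in> hessian_domain (ternary_cubic c)"
  shows "- 4 * det (hessian_metric (ternary_cubic c) x) * curvature (hessian_metric (ternary_cubic c)) i j k l x
    = gauss_form c x i j k l"
proof -
  let ?g = "hessian_metric (ternary_cubic c) x"
  have d: "det ?g \<noteq> 0"
    using assms by (simp add: hessian_domain_def det_hessian_metric)
  have "- 4 * det ?g * curvature (hessian_metric (ternary_cubic c)) i j k l x
    = (\<Sum>p\<in>UNIV. \<Sum>q\<in>UNIV. det ?g * matrix_inv ?g $ p $ q *
      (cubic_coeff c j l p * cubic_coeff c i k q - cubic_coeff c i l p * cubic_coeff c j k q))"
    unfolding curvature_hessian_metric[OF assms] partial3
    by (simp add: sum_distrib_left algebra_simps)
  then show ?thesis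
    unfolding det_mult_matrix_inv_3[OF d] gauss_form_def
    by (simp add: cofactor_hessian_metric_sym)
qed

lemma gauss_form_skew: "gauss_form c x j i k l = - gauss_form c x i j k l"
  unfolding gauss_form_def sum_negf[symmetric] by (simp add: algebra_simps)

lemma gauss_form_pair_sym: "gauss_form c x k l i j = gauss_form c x i j k l"
proof -
  let ?M = "cofactor (hessian_metric (ternary_cubic c) x)"
  have "(\<Sum>p\<in>UNIV. \<Sum>q\<in>UNIV. ?M p q * (cubic_coeff c k j p * cubic_coeff c l i q))
    = (\<Sum>p\<in>UNIV. \<Sum>q\<in>UNIV. ?M q p * (cubic_coeff c k j q * cubic_coeff c l i p))"
    by (rule sum.swap)
  also have "\<dots> = (\<Sum>p\<in>UNIV. \<Sum>q\<in>UNIV. ?M p q * (cubic_coeff c i l p * cubic_coeff c j k q))"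
    by (simp add: cofactor_hessian_metric_sym mult.commute cubic_coeff_sym(1)[of c k j] cubic_coeff_sym(1)[of c l i])
  finally show ?thesis
    by (simp add: gauss_form_def right_diff_distrib sum_subtractf
        cubic_coeff_sym(1)[of c l j] cubic_coeff_sym(1)[of c k i])
qed

text \<open>
  The computational heart: polynomial identities of degree four in the coefficients and
  two in \<open>x\<close>. The index pairs \<open>23\<close>, \<open>31\<close>, \<open>12\<close> are in cyclic order, so that they stand for
  the coordinates \<open>1\<close>, \<open>2\<close>, \<open>3\<close> without signs. Pair symmetry leaves six of the nine products.
\<close>

lemma gauss_form_components:
  "gauss_form c x 2 3 2 3 = S_invariant c * x $ 1 * x $ 1"
  "gauss_form c x 3 1 3 1 = S_invariant c * x $ 2 * x $ 2"
  "gauss_form c x 1 2 1 2 = S_invariant c * x $ 3 * x $ 3"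
  "gauss_form c x 2 3 3 1 = S_invariant c * x $ 1 * x $ 2"
  "gauss_form c x 3 1 1 2 = S_invariant c * x $ 2 * x $ 3"
  "gauss_form c x 1 2 2 3 = S_invariant c * x $ 3 * x $ 1"
  unfolding gauss_form_def cofactor_def sum_3 S_invariant_def hm
  by (simp_all add: numerals_3_wrap sum_3 cubic_coeff_def Let_def numeral_eq_Suc, algebra+)

text \<open>
  The isomorphism of bivectors with vectors in dimension three, in coordinates. It reduces
  a statement about a skew form to the three cyclic index pairs.
\<close>

lemma skew_3_eq_cross:
  fixes T :: "3 \<Rightarrow> 3 \<Rightarrow> real"
  assumes "\<And>i j. T j i = - T i j"
  shows "T i j = (axis i 1 \<times> axis j 1) \<bullet> vector [T 2 3, T 3 1, T 1 2]"
proof -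
  have "T i i = 0" for i
    using assms[of i i] by simp
  moreover have "T 3 2 = - T 2 3" "T 1 3 = - T 3 1" "T 2 1 = - T 1 2"
    by (rule assms)+
  ultimately show ?thesis
    using exhaust_3[of i] exhaust_3[of j]
    by (elim disjE) (simp_all add: cross3_def inner_vec_def sum_3 vector_3 axis_def)
qed

text \<open>
  Apply the bivector isomorphism to the pair \<open>k, l\<close> with \<open>i, j\<close> a cyclic pair, then to \<open>i, j\<close>. Each
  time the vector that appears is a multiple of \<open>x\<close>.
\<close>

lemma gauss_form_eq:
  "gauss_form c x i j k l
    = S_invariant c * ((axis i 1 \<times> axis j 1) \<bullet> x) * ((axis k 1 \<times> axis l 1) \<bullet> x)"
proof -
  let ?S = "S_invariant c"
  have row: "gauss_form c x m n k l = ?S * x $ r * ((axis k 1 \<times> axis l 1) \<bullet> x)"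
    if "gauss_form c x m n 2 3 = ?S * x $ r * x $ 1" "gauss_form c x m n 3 1 = ?S * x $ r * x $ 2"
      "gauss_form c x m n 1 2 = ?S * x $ r * x $ 3" for m n r
  proof -
    have "gauss_form c x m n j i = - gauss_form c x m n i j" for i j
      by (metis gauss_form_pair_sym gauss_form_skew)
    then have "gauss_form c x m n k l = (axis k 1 \<times> axis l 1) \<bullet>
        vector [gauss_form c x m n 2 3, gauss_form c x m n 3 1, gauss_form c x m n 1 2]"
      by (rule skew_3_eq_cross)
    then show ?thesis
      unfolding that by (simp add: inner_vec_def sum_3 vector_3 algebra_simps)
  qed
  have "gauss_form c x 2 3 k l = ?S * x $ 1 * ((axis k 1 \<times> axis l 1) \<bullet> x)"
    using gauss_form_pair_sym[of c x 2 3 1 2] by (intro row) (simp_all add: gauss_form_components)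
  moreover have "gauss_form c x 3 1 k l = ?S * x $ 2 * ((axis k 1 \<times> axis l 1) \<bullet> x)"
    using gauss_form_pair_sym[of c x 3 1 2 3] by (intro row) (simp_all add: gauss_form_components)
  moreover have "gauss_form c x 1 2 k l = ?S * x $ 3 * ((axis k 1 \<times> axis l 1) \<bullet> x)"
    using gauss_form_pair_sym[of c x 1 2 3 1] by (intro row) (simp_all add: gauss_form_components)
  ultimately show ?thesis
    using skew_3_eq_cross[of "\<lambda>i j. gauss_form c x i j k l", OF gauss_form_skew, of i j]
    by (simp add: inner_vec_def sum_3 vector_3 algebra_simps)
qed

text \<open>
  The coordinate and the sign come from the indices alone and not from \<open>x\<close>. The first claim about
  the curvature asks for exactly this uniformity.
\<close>

lemma cross_axis_inner:
  fixes i j :: 3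
  assumes "i \<noteq> j"
  obtains a :: 3 and s :: real
  where "s \<in> {1, - 1}" "\<And>x. (axis i 1 \<times> axis j 1) \<bullet> x = s * x $ a"
proof -
  have "j = i + 1 \<or> j = i + 2"
    using assms exhaust_3[of i] exhaust_3[of j] by (elim disjE) (simp_all add: numerals_3_wrap)
  then show thesis
  proof
    assume "j = i + 1"
    then have "axis i 1 \<times> axis j 1 = 1 *\<^sub>R axis (i + 2) (1::real)"
      using exhaust_3[of i] by (elim disjE) (simp_all add: cross_basis numerals_3_wrap)
    then show thesis
      by (intro that[of 1 "i + 2"]) (simp_all add: inner_axis')
  next
    assume "j = i + 2"
    then have "axis i 1 \<times> axis j 1 = - axis (i + 1) (1::real)"
      using exhaust_3[of i] by (elim disjE) (simp_all add: cross_basis numerals_3_wrap)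
    then show thesis
      by (intro that[of "- 1" "i + 1"]) (simp_all add: inner_axis')
  qed
qed

lemma curvature_ternary_cubic:
  assumes "x \<in> hessian_domain (ternary_cubic c)"
  shows "- 4 * det (hessian_metric (ternary_cubic c) x) * curvature (hessian_metric (ternary_cubic c)) i j k l x
    = S_invariant c * ((axis i 1 \<times> axis j 1) \<bullet> x) * ((axis k 1 \<times> axis l 1) \<bullet> x)"
  using assms by (simp only: curvature_eq_gauss_form gauss_form_eq)

lemma cross_inner_eq_sum:
  "(\<xi> \<times> \<eta>) \<bullet> x = (\<Sum>i\<in>UNIV. \<Sum>j\<in>UNIV. ((axis i 1 \<times> axis j 1) \<bullet> x) * \<xi> $ i * \<eta> $ j)"
  by (simp add: sum_3 cross3_def inner_vec_def vector_3 axis_def algebra_simps)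

lemma curvature_form_ternary_cubic:
  assumes "x \<in> hessian_domain (ternary_cubic c)"
  shows "- 4 * det (hessian_metric (ternary_cubic c) x)
      * curvature_form (hessian_metric (ternary_cubic c)) x \<xi> \<eta> \<zeta> \<theta>
    = S_invariant c * ((\<xi> \<times> \<eta>) \<bullet> x) * ((\<zeta> \<times> \<theta>) \<bullet> x)"
proof -
  let ?h = "det (hessian_metric (ternary_cubic c) x)"
  let ?R = "\<lambda>i j k l. curvature (hessian_metric (ternary_cubic c)) i j k l x"
  let ?u = "\<lambda>i j. (axis i 1 \<times> axis j 1) \<bullet> x"
  have "- 4 * ?h * curvature_form (hessian_metric (ternary_cubic c)) x \<xi> \<eta> \<zeta> \<theta>
    = (\<Sum>i\<in>UNIV. \<Sum>j\<in>UNIV. \<Sum>k\<in>UNIV. \<Sum>l\<in>UNIV. (- 4 * ?h * ?R i j k l) * \<xi> $ i * \<eta> $ j * \<zeta> $ k * \<theta> $ l)"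
    unfolding curvature_form_def sum_distrib_left by (simp only: mult.assoc)
  also have "\<dots> = (\<Sum>i\<in>UNIV. \<Sum>j\<in>UNIV. \<Sum>k\<in>UNIV. \<Sum>l\<in>UNIV.
      S_invariant c * (?u i j * \<xi> $ i * \<eta> $ j) * (?u k l * \<zeta> $ k * \<theta> $ l))"
    unfolding curvature_ternary_cubic[OF assms] by (simp only: mult_ac)
  \<comment> \<open>The four-fold sum factors because each summand is a product of a term in \<open>i, j\<close> and one in \<open>k, l\<close>.\<close>
  also have "\<dots> = S_invariant c * ((\<xi> \<times> \<eta>) \<bullet> x) * ((\<zeta> \<times> \<theta>) \<bullet> x)"
    unfolding cross_inner_eq_sum[of \<xi>] cross_inner_eq_sum[of \<zeta>]
    by (simp only: sum_distrib_left[symmetric] sum_distrib_right[symmetric])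
  finally show ?thesis .
qed

theorem theorem1p3:
  shows "(\<forall>i j k l :: 3. i \<noteq> j \<and> k \<noteq> l \<longrightarrow>
      (\<exists>a b :: 3. \<exists>s \<in> {1, - 1 :: real}.
        \<forall>c :: nat \<Rightarrow> nat \<Rightarrow> nat \<Rightarrow> real. nondegenerate (ternary_cubic c) \<longrightarrow>
          (\<forall>x \<in> hessian_domain (ternary_cubic c).
            curvature (hessian_metric (ternary_cubic c)) i j k l x
              = s * (1/4) * (S_invariant c * x$a * x$b / det (hessian_metric (ternary_cubic c) x)))))
    \<and>
    (\<forall>c :: nat \<Rightarrow> nat \<Rightarrow> nat \<Rightarrow> real. nondegenerate (ternary_cubic c) \<longrightarrow>
      (\<forall>x \<in> hessian_domain (ternary_cubic c). \<forall>\<xi> \<eta> :: real^3.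
        - 4 * det (hessian_metric (ternary_cubic c) x)
            * curvature_form (hessian_metric (ternary_cubic c)) x \<xi> \<eta> \<xi> \<eta>
          = S_invariant c *
            (\<xi>$1 * \<eta>$2 * x$3 + \<xi>$2 * \<eta>$3 * x$1 + \<xi>$3 * \<eta>$1 * x$2
             - \<xi>$2 * \<eta>$1 * x$3 - \<xi>$3 * \<eta>$2 * x$1 - \<xi>$1 * \<eta>$3 * x$2)^2))"
proof (intro conjI allI impI ballI)
  fix i j k l :: 3
  assume ne: "i \<noteq> j \<and> k \<noteq> l"
  obtain a s where s: "s \<in> {1, - 1 :: real}" and a: "\<And>x. (axis i 1 \<times> axis j 1) \<bullet> x = s * x $ a"
    using ne cross_axis_inner by metis
  obtain b t where t: "t \<in> {1, - 1 :: real}" and b: "\<And>x. (axis k 1 \<times> axis l 1) \<bullet> x = t * x $ b"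
    using ne cross_axis_inner by metis
  have "curvature (hessian_metric (ternary_cubic c)) i j k l x
      = (- s * t) * (1/4) * (S_invariant c * x$a * x$b / det (hessian_metric (ternary_cubic c) x))"
    if x: "x \<in> hessian_domain (ternary_cubic c)" for c x
  proof -
    have "det (hessian_metric (ternary_cubic c) x) \<noteq> 0"
      using x by (simp add: hessian_domain_def det_hessian_metric)
    then show ?thesis
      using curvature_ternary_cubic[OF x, of i j k l] unfolding a b by (simp add: field_simps)
  qed
  moreover have "- s * t \<in> {1, - 1}"
    using s t by auto
  ultimately show "\<exists>a b :: 3. \<exists>s \<in> {1, - 1 :: real}.
        \<forall>c :: nat \<Rightarrow> nat \<Rightarrow> nat \<Rightarrow> real. nondegenerate (ternary_cubic c) \<longrightarrow>
          (\<forall>x \<in> hessian_domain (ternary_cubic c).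
            curvature (hessian_metric (ternary_cubic c)) i j k l x
              = s * (1/4) * (S_invariant c * x$a * x$b / det (hessian_metric (ternary_cubic c) x)))"
    by blast
next
  fix c x and \<xi> \<eta> :: "real^3"
  assume "x \<in> hessian_domain (ternary_cubic c)"
  moreover have "(\<xi> \<times> \<eta>) \<bullet> x = \<xi>$1 * \<eta>$2 * x$3 + \<xi>$2 * \<eta>$3 * x$1 + \<xi>$3 * \<eta>$1 * x$2
             - \<xi>$2 * \<eta>$1 * x$3 - \<xi>$3 * \<eta>$2 * x$1 - \<xi>$1 * \<eta>$3 * x$2"
    by (simp add: cross3_def inner_vec_def sum_3 vector_3 algebra_simps)
  ultimately show "- 4 * det (hessian_metric (ternary_cubic c) x)
            * curvature_form (hessian_metric (ternary_cubic c)) x \<xi> \<eta> \<xi> \<eta>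
          = S_invariant c *
            (\<xi>$1 * \<eta>$2 * x$3 + \<xi>$2 * \<eta>$3 * x$1 + \<xi>$3 * \<eta>$1 * x$2
             - \<xi>$2 * \<eta>$1 * x$3 - \<xi>$3 * \<eta>$2 * x$1 - \<xi>$1 * \<eta>$3 * x$2)^2"
    by (simp only: curvature_form_ternary_cubic power2_eq_square mult.assoc[symmetric])
qed

end
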